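(* Every regular $\mathscr{D}$-class of the endomorphism monoid of the countable universal directed graph $D$ contains $2^{\aleph_0}$ many $\mathscr{L}$-classes and $2^{\aleph_0}$ many $\mathscr{R}$-classes.
   Context: A directed graph is a pair $(V,E)$ with $E$ an irreflexive binary relation on $V$. The countable universal directed graph $D$ is the Fraïssé limit of the finite directed graphs; $\operatorname{End} D$ is its endomorphism monoid. Green's relations on a monoid $M$: $f\,\mathscr{L}\,g$ iff $Mf=Mg$; $f\,\mathscr{R}\,g$ iff $fM=gM$; $\mathscr{D}=\mathscr{L}\circ\mathscr{R}$. An element $f$ is regular if $fgf=f$ for some $g\in M$; a regular $\mathscr{D}$-class consists of regular elements. *)

theory Defs
  imports "HOL-Algebra.Coset" "HOL-Library.Equipollence" "HOL-Library.Countable_Set"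
begin

section \<open>Directed graphs and the Fraisse limit of the finite directed graphs\<close>

type_synonym 'a graph = "'a set \<times> 'a rel"

abbreviation verts :: "'a graph \<Rightarrow> 'a set" where "verts \<equiv> fst"
abbreviation edges :: "'a graph \<Rightarrow> 'a rel" where "edges \<equiv> snd"

definition directed_graph :: "'a graph \<Rightarrow> bool" where
  "directed_graph G \<longleftrightarrow> edges G \<subseteq> verts G \<times> verts G \<and> irrefl (edges G)"

definition induced :: "'a graph \<Rightarrow> 'a set \<Rightarrow> 'a graph" where
  "induced G A = (A, edges G \<inter> A \<times> A)"

definition embedding :: "('a \<Rightarrow> 'b) \<Rightarrow> 'a graph \<Rightarrow> 'b graph \<Rightarrow> bool" where
  "embedding f G H \<longleftrightarrow> f \<in> verts G \<rightarrow> verts H \<and> inj_on f (verts G) \<and>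
     (\<forall>x\<in>verts G. \<forall>y\<in>verts G. (x, y) \<in> edges G \<longleftrightarrow> (f x, f y) \<in> edges H)"

definition isomorphism :: "('a \<Rightarrow> 'b) \<Rightarrow> 'a graph \<Rightarrow> 'b graph \<Rightarrow> bool" where
  "isomorphism f G H \<longleftrightarrow> embedding f G H \<and> f ` verts G = verts H"

definition homogeneous :: "'a graph \<Rightarrow> bool" where
  "homogeneous G \<longleftrightarrow>
     (\<forall>A B f. A \<subseteq> verts G \<and> finite A \<and> B \<subseteq> verts G \<and> finite B \<and>
        isomorphism f (induced G A) (induced G B) \<longrightarrow>
        (\<exists>g. isomorphism g G G \<and> (\<forall>x\<in>A. g x = f x)))"

text \<open>Every finite graph is isomorphic to one whose vertices are natural numbers, so isomorphism-closed
  classes of finite graphs, such as the age, are represented by their members with vertices in \<^typ>\<open>nat\<close>.\<close>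

definition age :: "'a graph \<Rightarrow> nat graph set" where
  "age G = {H. finite (verts H) \<and> edges H \<subseteq> verts H \<times> verts H \<and> (\<exists>f. embedding f H G)}"

definition fraisse_limit :: "nat graph set \<Rightarrow> 'a graph \<Rightarrow> bool" where
  "fraisse_limit K G \<longleftrightarrow> countable (verts G) \<and> homogeneous G \<and> age G = K"

definition universal_directed_graph :: "'a graph \<Rightarrow> bool" where
  "universal_directed_graph G \<longleftrightarrow> directed_graph G \<and>
     fraisse_limit {H. directed_graph H \<and> finite (verts H)} G"

section \<open>The endomorphism monoid\<close>

text \<open>Endomorphisms are extensional functions, i.e. \<^const>\<open>undefined\<close> outside the vertex set, so
  that distinct elements of the carrier are distinct maps on the vertices.\<close>

definition End :: "'a graph \<Rightarrow> ('a \<Rightarrow> 'a) monoid" where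
  "End G = \<lparr>carrier = {f \<in> verts G \<rightarrow>\<^sub>E verts G. \<forall>(x, y)\<in>edges G. (f x, f y) \<in> edges G},
            monoid.mult = compose (verts G),
            one = (\<lambda>x\<in>verts G. x)\<rparr>"

lemma monoid_End:
  assumes "directed_graph G"
  shows "monoid (End G)"
proof -
  have E: "(x, y) \<in> edges G \<Longrightarrow> x \<in> verts G \<and> y \<in> verts G" for x y
    using assms unfolding directed_graph_def by blast
  have mem: "f \<in> carrier (End G) \<longleftrightarrow> f \<in> verts G \<rightarrow>\<^sub>E verts G \<and>
      (\<forall>x y. (x, y) \<in> edges G \<longrightarrow> (f x, f y) \<in> edges G)" for f
    by (simp add: End_def split_beta' Ball_def)
  have mult: "f \<otimes>\<^bsub>End G\<^esub> g = compose (verts G) f g" for f g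
    by (simp add: End_def)
  have one: "\<one>\<^bsub>End G\<^esub> = (\<lambda>x\<in>verts G. x)"
    by (simp add: End_def)
  show ?thesis
  proof (rule monoidI, unfold mult one)
    fix f g assume "f \<in> carrier (End G)" "g \<in> carrier (End G)"
    then show "compose (verts G) f g \<in> carrier (End G)"
      unfolding mem by (auto simp: compose_def dest: E)
  next
    show "(\<lambda>x\<in>verts G. x) \<in> carrier (End G)"
      unfolding mem by (auto dest: E)
  next
    fix f g h assume "h \<in> carrier (End G)"
    then show "compose (verts G) (compose (verts G) f g) h =
        compose (verts G) f (compose (verts G) g h)"
      unfolding mem by (auto simp: compose_def fun_eq_iff)
  next
    fix f assume "f \<in> carrier (End G)"
    then have f: "f \<in> verts G \<rightarrow>\<^sub>E verts G" unfolding mem by blast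
    show "compose (verts G) (\<lambda>x\<in>verts G. x) f = f"
      using f by (intro extensionalityI[of _ "verts G"]) (auto simp: compose_def PiE_def)
    show "compose (verts G) f (\<lambda>x\<in>verts G. x) = f"
      using f by (intro extensionalityI[of _ "verts G"]) (auto simp: compose_def PiE_def)
  qed
qed

section \<open>Green's relations\<close>

text \<open>Here \<^term>\<open>carrier M #>\<^bsub>M\<^esub> f\<close> is the principal left ideal \<open>M f\<close> and \<^term>\<open>f <#\<^bsub>M\<^esub> carrier M\<close> the
  principal right ideal \<open>f M\<close>.\<close>

definition green_L :: "('a, 'b) monoid_scheme \<Rightarrow> 'a rel" where
  "green_L M = {(f, g). f \<in> carrier M \<and> g \<in> carrier M \<and> carrier M #>\<^bsub>M\<^esub> f = carrier M #>\<^bsub>M\<^esub> g}"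

definition green_R :: "('a, 'b) monoid_scheme \<Rightarrow> 'a rel" where
  "green_R M = {(f, g). f \<in> carrier M \<and> g \<in> carrier M \<and> f <#\<^bsub>M\<^esub> carrier M = g <#\<^bsub>M\<^esub> carrier M}"

definition green_D :: "('a, 'b) monoid_scheme \<Rightarrow> 'a rel" where
  "green_D M = green_L M O green_R M"

definition regular_element :: "('a, 'b) monoid_scheme \<Rightarrow> 'a \<Rightarrow> bool" where
  "regular_element M f \<longleftrightarrow> f \<in> carrier M \<and> (\<exists>g\<in>carrier M. f \<otimes>\<^bsub>M\<^esub> g \<otimes>\<^bsub>M\<^esub> f = f)"

definition regular_D_class :: "('a, 'b) monoid_scheme \<Rightarrow> 'a set \<Rightarrow> bool" where
  "regular_D_class M C \<longleftrightarrow> C \<in> carrier M // green_D M \<and> (\<forall>f\<in>C. regular_element M f)"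

end

theory Submission imports Defs begin

text \<open>Any countable digraph X embeds in D so that every vertex off the image has only finitely many
  neighbours in the image. Since any finitely many vertices of D have a common neighbour, joined to
  each of them in both directions, every homomorphism from X to D then extends to an endomorphism.

  If \<open>k h = 1\<close> in a monoid, then \<open>h f\<close> is L-related and \<open>f k\<close> is R-related to \<open>f\<close>. So it suffices
  to vary \<open>h\<close> or \<open>k\<close> such that the elements \<open>h f\<close> have many images and the elements \<open>f k\<close> many
  kernels. For images, X is D with every vertex doubled: choosing one copy of each vertex gives many
  sections \<open>h\<close> of one retraction \<open>k\<close>. For kernels, X is D with infinitely many isolated vertices added,
  each of which \<open>k\<close> may send to either of two vertices separated by \<open>f\<close>.\<close>

section \<open>The universal directed graph\<close>

lemma universal_directed_graph_edges:
  assumes "universal_directed_graph D" "(x, y) \<in> edges D"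
  shows "x \<in> verts D" "y \<in> verts D" "x \<noteq> y"
  using assms unfolding universal_directed_graph_def directed_graph_def irrefl_def by auto

lemma universal_directed_graph_irrefl:
  assumes "universal_directed_graph D"
  shows "(x, x) \<notin> edges D"
  using universal_directed_graph_edges(3)[OF assms] by blast

text \<open>The age supplies an abstract one-point extension of \<open>A\<close> somewhere in
  \<open>D\<close>; homogeneity carries its copy of \<open>A\<close> back onto \<open>A\<close>
  itself and takes the extra vertex to \<open>v\<close>.\<close>

lemma universal_directed_graph_extension:
  assumes D: "universal_directed_graph D" and A: "finite A" "A \<subseteq> verts D"
  shows "\<exists>v \<in> verts D - A. \<forall>a\<in>A. ((v, a) \<in> edges D \<longleftrightarrow> P a) \<and> ((a, v) \<in> edges D \<longleftrightarrow> Q a)"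
proof -
  have hom: "homogeneous D" and age: "age D = {H. directed_graph H \<and> finite (verts H)}"
    using D by (auto simp: universal_directed_graph_def fraisse_limit_def)
  obtain g :: "'a \<Rightarrow> nat" and n where g: "bij_betw g A {0..<n}"
    using ex_bij_betw_finite_nat[OF A(1)] by blast
  have g_inj: "inj_on g A" and g_less: "\<And>a. a \<in> A \<Longrightarrow> g a < n"
    using g by (auto simp: bij_betw_def)
  have g_eq: "g a = g b \<longleftrightarrow> a = b" if "a \<in> A" "b \<in> A" for a b
    using g_inj that by (auto dest: inj_onD)
  \<comment> \<open>\<open>F\<close> copies \<open>D\<close> on \<open>A\<close> to the labels below
    \<open>n\<close> via \<open>g\<close> and adds \<open>n\<close> as the new vertex, with arcs to
    and from \<open>A\<close> prescribed by \<open>P\<close> and \<open>Q\<close>.\<close>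
  define F where "F = {(g a, g b) |a b. a \<in> A \<and> b \<in> A \<and> (a, b) \<in> edges D}
    \<union> {(n, g a) |a. a \<in> A \<and> P a} \<union> {(g a, n) |a. a \<in> A \<and> Q a}"
  have F1: "(g a, g b) \<in> F \<longleftrightarrow> (a, b) \<in> edges D" if "a \<in> A" "b \<in> A" for a b
    using that g_less[of a] g_less[of b] by (auto simp: F_def g_eq)
  have F2: "(n, g a) \<in> F \<longleftrightarrow> P a" "(g a, n) \<in> F \<longleftrightarrow> Q a" if "a \<in> A" for a
    using that g_less[of a] by (auto simp: F_def g_eq dest: g_less)
  have "directed_graph ({..n}, F)"
    unfolding directed_graph_def irrefl_def
    using universal_directed_graph_irrefl[OF D]
    by (auto simp: F_def g_eq less_imp_le dest: g_less)
  then have "({..n}, F) \<in> age D" by (simp add: age)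
  then obtain f where f: "embedding f ({..n}, F) D" by (auto simp: age_def)
  have f_in: "f i \<in> verts D" if "i \<le> n" for i
    using f that by (auto simp: embedding_def)
  have f_eq: "f i = f j \<longleftrightarrow> i = j" if "i \<le> n" "j \<le> n" for i j
    using f that by (auto simp: embedding_def inj_on_def)
  have f_edge: "(f i, f j) \<in> edges D \<longleftrightarrow> (i, j) \<in> F" if "i \<le> n" "j \<le> n" for i j
    using f that by (auto simp: embedding_def)
  define B where "B = (\<lambda>a. f (g a)) ` A"
  define i where "i = inv_into A (\<lambda>a. f (g a))"
  have fg_inj: "inj_on (\<lambda>a. f (g a)) A"
    by (auto simp: inj_on_def f_eq g_eq g_less less_imp_le)
  have i: "i (f (g a)) = a" if "a \<in> A" for a
    using inv_into_f_f[OF fg_inj that] by (simp add: i_def)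
  have B: "finite B" "B \<subseteq> verts D"
    using A f_in g_less by (auto simp: B_def less_imp_le)
  \<comment> \<open>\<open>i\<close> undoes \<open>f\<close> after \<open>g\<close>, so it is a
    finite partial isomorphism of \<open>D\<close>. For the automorphism \<open>t\<close> extending
    it, \<open>t (f n)\<close> is the vertex sought.\<close>
  have "isomorphism i (induced D B) (induced D A)"
    unfolding isomorphism_def embedding_def induced_def
    by (auto simp: B_def i inj_on_def image_image f_edge F1 g_less less_imp_le)
  then obtain t where t: "isomorphism t D D" and t_eq: "\<And>x. x \<in> B \<Longrightarrow> t x = i x"
    using hom A B unfolding homogeneous_def by meson
  have t_in: "t x \<in> verts D" if "x \<in> verts D" for x
    using t that by (auto simp: isomorphism_def)
  have t_inj: "inj_on t (verts D)" using t by (simp add: isomorphism_def embedding_def)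
  have t_edge: "(t x, t y) \<in> edges D \<longleftrightarrow> (x, y) \<in> edges D" if "x \<in> verts D" "y \<in> verts D" for x y
    using t that by (auto simp: isomorphism_def embedding_def)
  have t_fg: "t (f (g a)) = a" if "a \<in> A" for a
    using that t_eq[of "f (g a)"] i by (auto simp: B_def)
  have le: "g a \<le> n" if "a \<in> A" for a using g_less[OF that] by simp
  show ?thesis
  proof (intro bexI ballI)
    show "t (f n) \<in> verts D - A"
    proof
      show "t (f n) \<in> verts D" using t_in f_in by simp
      show "t (f n) \<notin> A"
      proof
        assume a: "t (f n) \<in> A"
        then have "f n = f (g (t (f n)))"
          using t_fg[OF a] t_inj f_in le by (metis inj_onD order_refl)
        then show False using f_eq le[OF a] g_less[OF a] by simp
      qed
    qed
    fix a assume a: "a \<in> A"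
    have "(t (f n), t (f (g a))) \<in> edges D \<longleftrightarrow> P a" "(t (f (g a)), t (f n)) \<in> edges D \<longleftrightarrow> Q a"
      using a by (simp_all add: t_edge f_in f_edge le F2)
    then show "((t (f n), a) \<in> edges D \<longleftrightarrow> P a) \<and> ((a, t (f n)) \<in> edges D \<longleftrightarrow> Q a)"
      using a by (simp add: t_fg)
  qed
qed

section \<open>Extending homomorphisms to endomorphisms\<close>

definition graph_hom :: "('b \<Rightarrow> 'a) \<Rightarrow> 'b graph \<Rightarrow> 'a graph \<Rightarrow> bool" where
  "graph_hom f X D \<longleftrightarrow> f \<in> verts X \<rightarrow> verts D \<and> (\<forall>(x, y)\<in>edges X. (f x, f y) \<in> edges D)"

lemma finite_initial_segment:
  fixes c :: "'b \<Rightarrow> nat"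
  assumes "inj_on c S"
  shows "finite {y\<in>S. c y < n}"
proof (rule inj_on_finite)
  show "inj_on c {y\<in>S. c y < n}" using assms by (auto simp: inj_on_def)
  show "c ` {y\<in>S. c y < n} \<subseteq> {..<n}" by auto
qed simp

text \<open>The vertices of \<open>X\<close> are placed in the order of a numbering
  \<open>c\<close>, and the image of \<open>x\<close> is kept nonadjacent to every vertex of
  \<open>D\<close> with number below \<open>c x\<close>, earlier images excepted. A vertex
  \<open>d\<close> off the image can then be adjacent to \<open>j x\<close> only if
  \<open>c x \<le> e d\<close>, which leaves finitely many \<open>x\<close>.\<close>

lemma exists_sparse_embedding:
  fixes X :: "'b graph" and D :: "'a graph"
  assumes D: "universal_directed_graph D" and X: "directed_graph X" "countable (verts X)"
  shows "\<exists>j. embedding j X D \<and>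
    (\<forall>d\<in>verts D - j ` verts X. finite {x\<in>verts X. (j x, d) \<in> edges D \<or> (d, j x) \<in> edges D})"
proof -
  obtain c :: "'b \<Rightarrow> nat" where c: "inj_on c (verts X)"
    using X(2) by (auto simp: countable_def)
  obtain e :: "'a \<Rightarrow> nat" where e: "inj_on e (verts D)"
    using D by (auto simp: universal_directed_graph_def fraisse_limit_def countable_def)
  define pre where "pre x = {y\<in>verts X. c y < c x}" for x
  have pre_fin: "finite (pre x)" for x
    unfolding pre_def using finite_initial_segment[OF c] .
  \<comment> \<open>\<open>r\<close> is an admissible value at \<open>x\<close>, given
    \<open>j\<close> on \<open>pre x\<close>: the clause over \<open>pre x\<close> makes
    \<open>j\<close> an embedding, the last one makes it sparse. Off \<open>verts X\<close> the
    condition is vacuous, so the recursion can run over the whole type.\<close>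
  define R where "R j x r \<longleftrightarrow> (x \<in> verts X \<longrightarrow> r \<in> verts D \<and>
      (\<forall>y\<in>pre x. r \<noteq> j y \<and> ((r, j y) \<in> edges D \<longleftrightarrow> (x, y) \<in> edges X) \<and>
                  ((j y, r) \<in> edges D \<longleftrightarrow> (y, x) \<in> edges X)) \<and>
      (\<forall>d\<in>verts D. e d < c x \<and> d \<notin> j ` pre x \<longrightarrow> (r, d) \<notin> edges D \<and> (d, r) \<notin> edges D))"
    for j :: "'b \<Rightarrow> 'a" and x r
  have "\<exists>j. \<forall>x. R j x (j x)"
  proof (rule dependent_wf_choice[of "measure c"])
    show "wf (measure c)" by simp
    show "R f x r = R g x r" if "\<And>z. (z, x) \<in> measure c \<Longrightarrow> f z = g z" for f g x r
    proof -
      have "f y = g y" if "y \<in> pre x" for y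
        using that \<open>\<And>z. (z, x) \<in> measure c \<Longrightarrow> f z = g z\<close> by (simp add: pre_def)
      then have "f ` pre x = g ` pre x" "\<forall>y\<in>pre x. f y = g y" by auto
      then show ?thesis unfolding R_def by simp
    qed
    show "\<exists>r. R j x r" if "\<And>y. (y, x) \<in> measure c \<Longrightarrow> R j y (j y)" for x j
    proof (cases "x \<in> verts X")
      case True
      have IH: "R j y (j y)" if "y \<in> pre x" for y
        using that \<open>\<And>y. (y, x) \<in> measure c \<Longrightarrow> R j y (j y)\<close> by (simp add: pre_def)
      have j_in: "j y \<in> verts D" if "y \<in> pre x" for y
        using IH[OF that] that by (simp add: R_def pre_def)
      have j_ne: "j y \<noteq> j z" if "y \<in> pre x" "z \<in> pre x" "c y < c z" for y z
        using IH[OF that(2)] that by (force simp: R_def pre_def)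
      have j_eq: "j y = j z \<longleftrightarrow> y = z" if "y \<in> pre x" "z \<in> pre x" for y z
        using j_ne[OF that] j_ne[OF that(2,1)] that c
        by (metis (mono_tags, lifting) inj_onD linorder_neqE_nat mem_Collect_eq pre_def)
      define A where "A = j ` pre x \<union> {d\<in>verts D. e d < c x}"
      have "finite A" "A \<subseteq> verts D"
        using pre_fin finite_initial_segment[OF e] j_in by (auto simp: A_def)
      \<comment> \<open>Both predicates require \<open>a\<close> to be an earlier image, so the
        other vertices of \<open>A\<close> receive no arcs to or from \<open>r\<close>.\<close>
      from universal_directed_graph_extension[OF D this,
          of "\<lambda>a. \<exists>y\<in>pre x. a = j y \<and> (x, y) \<in> edges X"
             "\<lambda>a. \<exists>y\<in>pre x. a = j y \<and> (y, x) \<in> edges X"]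
      obtain r where r: "r \<in> verts D - A"
        "\<And>a. a \<in> A \<Longrightarrow> (r, a) \<in> edges D \<longleftrightarrow> (\<exists>y\<in>pre x. a = j y \<and> (x, y) \<in> edges X)"
        "\<And>a. a \<in> A \<Longrightarrow> (a, r) \<in> edges D \<longleftrightarrow> (\<exists>y\<in>pre x. a = j y \<and> (y, x) \<in> edges X)"
        by blast
      have jA: "j y \<in> A" if "y \<in> pre x" for y using that by (simp add: A_def)
      have "R j x r"
        unfolding R_def
      proof (intro impI conjI ballI)
        show "r \<in> verts D" using r by simp
        fix y assume y: "y \<in> pre x"
        show "r \<noteq> j y" using r(1) jA[OF y] by auto
        show "(r, j y) \<in> edges D \<longleftrightarrow> (x, y) \<in> edges X"
          using r(2)[OF jA[OF y]] y j_eq[OF y] by auto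
        show "(j y, r) \<in> edges D \<longleftrightarrow> (y, x) \<in> edges X"
          using r(3)[OF jA[OF y]] y j_eq[OF y] by auto
      next
        fix d assume "d \<in> verts D" "e d < c x \<and> d \<notin> j ` pre x"
        then have "d \<in> A" "d \<notin> j ` pre x" by (auto simp: A_def)
        then show "(r, d) \<notin> edges D" "(d, r) \<notin> edges D" using r(2,3) by auto
      qed
      then show ?thesis by blast
    qed (simp add: R_def)
  qed
  then obtain j where j: "\<And>x. R j x (j x)" by blast
  have j_in: "j x \<in> verts D" if "x \<in> verts X" for x
    using j[of x] that by (simp add: R_def)
  have step: "j x \<noteq> j y \<and> ((j x, j y) \<in> edges D \<longleftrightarrow> (x, y) \<in> edges X) \<and>
      ((j y, j x) \<in> edges D \<longleftrightarrow> (y, x) \<in> edges X)"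
    if "x \<in> verts X" "y \<in> verts X" "c y < c x" for x y
    using j[of x] that by (simp add: R_def pre_def)
  have c_less: "c x < c y \<or> c y < c x" if "x \<in> verts X" "y \<in> verts X" "x \<noteq> y" for x y
    using c that by (metis inj_onD linorder_neqE_nat)
  have "embedding j X D"
    unfolding embedding_def
  proof (intro conjI ballI)
    show "inj_on j (verts X)" using step c_less by (metis inj_onI)
    fix x y assume "x \<in> verts X" "y \<in> verts X"
    moreover have "(x, x) \<notin> edges X" "(j x, j x) \<notin> edges D"
      using X(1) universal_directed_graph_irrefl[OF D] by (auto simp: directed_graph_def irrefl_def)
    ultimately show "(x, y) \<in> edges X \<longleftrightarrow> (j x, j y) \<in> edges D"
      using step c_less by metis
  qed (use j_in in auto)
  moreover have "finite {x\<in>verts X. (j x, d) \<in> edges D \<or> (d, j x) \<in> edges D}"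
    if d: "d \<in> verts D - j ` verts X" for d
  proof (rule finite_subset)
    have "c x \<le> e d" if "x \<in> verts X" "(j x, d) \<in> edges D \<or> (d, j x) \<in> edges D" for x
    proof (rule ccontr)
      assume "\<not> c x \<le> e d"
      moreover have "d \<notin> j ` pre x" using d by (auto simp: pre_def)
      ultimately show False using j[of x] that d by (auto simp: R_def)
    qed
    then show "{x\<in>verts X. (j x, d) \<in> edges D \<or> (d, j x) \<in> edges D} \<subseteq> {x\<in>verts X. c x < Suc (e d)}"
      by (auto simp: less_Suc_eq_le)
    show "finite {x\<in>verts X. c x < Suc (e d)}" using finite_initial_segment[OF c] .
  qed
  ultimately show ?thesis by blast
qed

lemma carrier_End_iff:
  "f \<in> carrier (End G) \<longleftrightarrow> f \<in> extensional (verts G) \<and> graph_hom f G G"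
  by (auto simp: End_def graph_hom_def PiE_def)

text \<open>Off the image of \<open>j\<close>, values are chosen in the order of a numbering of
  \<open>D\<close>. At each \<open>d\<close> only finitely many neighbours already have a value:
  those in the image, by sparseness, and those of smaller number. A vertex joined in both directions
  to all these values respects the arcs between \<open>d\<close> and these neighbours, whatever
  their direction.\<close>

lemma graph_hom_extends_along_sparse_embedding:
  fixes X :: "'b graph" and D :: "'a graph"
  assumes D: "universal_directed_graph D" and j: "embedding j X D"
    and sparse: "\<And>d. d \<in> verts D - j ` verts X \<Longrightarrow>
      finite {x\<in>verts X. (j x, d) \<in> edges D \<or> (d, j x) \<in> edges D}"
    and f: "graph_hom f X D"
  shows "\<exists>k\<in>carrier (End D). \<forall>x\<in>verts X. k (j x) = f x"
proof -
  obtain e :: "'a \<Rightarrow> nat" where e: "inj_on e (verts D)"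
    using D by (auto simp: universal_directed_graph_def fraisse_limit_def countable_def)
  define J where "J = j ` verts X"
  define val where "val k d = (if d \<in> J then f (inv_into (verts X) j d) else k d)" for k d
  \<comment> \<open>\<open>nb d\<close> collects the neighbours whose values are fixed before that
    of \<open>d\<close>: those in \<open>J\<close>, whatever their number, and the others of smaller
    number.\<close>
  define nb where "nb d = {d'\<in>verts D. (d' \<in> J \<or> e d' < e d) \<and> ((d, d') \<in> edges D \<or> (d', d) \<in> edges D)}"
    for d
  define R where "R k d r \<longleftrightarrow> (d \<in> verts D - J \<longrightarrow> r \<in> verts D \<and>
      (\<forall>d'\<in>nb d. (r, val k d') \<in> edges D \<and> (val k d', r) \<in> edges D))" for k d r
  have j_inj: "inj_on j (verts X)" and j_in: "\<And>x. x \<in> verts X \<Longrightarrow> j x \<in> verts D"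
    using j by (auto simp: embedding_def)
  have val_J: "val k (j x) = f x" if "x \<in> verts X" for k x
    using that inv_into_f_f[OF j_inj that] by (simp add: val_def J_def)
  have f_in: "f x \<in> verts D" if "x \<in> verts X" for x using f that by (auto simp: graph_hom_def)
  have "\<exists>k. \<forall>d. R k d (k d)"
  proof (rule dependent_wf_choice[of "measure e"])
    show "wf (measure e)" by simp
    show "R k d r = R k' d r" if "\<And>z. (z, d) \<in> measure e \<Longrightarrow> k z = k' z" for k k' d r
    proof -
      have "\<forall>d'\<in>nb d. val k d' = val k' d'" using that by (auto simp: nb_def val_def)
      then show ?thesis by (simp add: R_def)
    qed
    show "\<exists>r. R k d r" if IH: "\<And>z. (z, d) \<in> measure e \<Longrightarrow> R k z (k z)" for d k
    proof (cases "d \<in> verts D - J")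
      case True
      have "nb d \<subseteq> j ` {x\<in>verts X. (j x, d) \<in> edges D \<or> (d, j x) \<in> edges D} \<union> {d'\<in>verts D. e d' < e d}"
        by (auto simp: nb_def J_def)
      moreover have "finite \<dots>"
        using sparse[of d] True finite_initial_segment[OF e] by (auto simp: J_def)
      ultimately have fin: "finite (val k ` nb d)" by (meson finite_imageI finite_subset)
      have "val k ` nb d \<subseteq> verts D"
      proof clarify
        fix d' assume d': "d' \<in> nb d"
        show "val k d' \<in> verts D"
        proof (cases "d' \<in> J")
          case True
          then show ?thesis using val_J f_in by (auto simp: J_def)
        next
          case False
          then show ?thesis using IH[of d'] d' by (auto simp: nb_def val_def R_def)
        qed
      qed
      from universal_directed_graph_extension[OF D fin this, of "\<lambda>_. True" "\<lambda>_. True"]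
      show ?thesis unfolding R_def by blast
    qed (auto simp: R_def)
  qed
  then obtain k where k: "\<And>d. R k d (k d)" by blast
  have val_in: "val k d \<in> verts D" if "d \<in> verts D" for d
    using k[of d] that val_J f_in by (cases "d \<in> J") (auto simp: R_def val_def J_def)
  have nb: "(val k d, val k d') \<in> edges D" "(val k d', val k d) \<in> edges D"
    if "d \<in> verts D - J" "d' \<in> nb d" for d d'
    using k[of d] that by (auto simp: R_def val_def[of k d])
  have edge: "(val k d, val k d') \<in> edges D" if dd': "(d, d') \<in> edges D" for d d'
  proof -
    note E = universal_directed_graph_edges[OF D dd']
    have "e d \<noteq> e d'" using E e by (auto dest: inj_onD)
    \<comment> \<open>An arc inside \<open>J\<close> is handled by \<open>f\<close>, since
      \<open>j\<close> reflects edges. Any other arc is settled at its endpoint off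
      \<open>J\<close>, the one of larger number if both are off \<open>J\<close>.\<close>
    then consider "d \<in> J" "d' \<in> J" | "d \<notin> J" "d' \<in> nb d" | "d' \<notin> J" "d \<in> nb d'"
      using E dd' unfolding nb_def by (cases "e d < e d'"; cases "d \<in> J"; cases "d' \<in> J") auto
    then show ?thesis
    proof cases
      case 1
      then obtain x y where xy: "x \<in> verts X" "y \<in> verts X" "d = j x" "d' = j y" by (auto simp: J_def)
      then have "(x, y) \<in> edges X" using j dd' by (auto simp: embedding_def)
      then show ?thesis using f xy val_J by (auto simp: graph_hom_def)
    qed (use nb E in auto)
  qed
  show ?thesis
  proof (intro bexI ballI)
    show "restrict (val k) (verts D) \<in> carrier (End D)"
      using val_in edge universal_directed_graph_edges[OF D]
      by (auto simp: carrier_End_iff graph_hom_def)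
    show "restrict (val k) (verts D) (j x) = f x" if "x \<in> verts X" for x
      using that j_in val_J by simp
  qed
qed

text \<open>One \<open>j\<close> serves all homomorphisms from \<open>X\<close>, so \<open>k\<close>
  can be varied while \<open>j\<close>, and with it a section \<open>h\<close>, stays fixed.\<close>

lemma exists_embedding_extending_homs:
  assumes "universal_directed_graph D" "directed_graph X" "countable (verts X)"
  obtains j where "embedding j X D"
    "\<And>f. graph_hom f X D \<Longrightarrow> \<exists>k\<in>carrier (End D). \<forall>x\<in>verts X. k (j x) = f x"
proof -
  from exists_sparse_embedding[OF assms] obtain j where j: "embedding j X D"
    "\<forall>d\<in>verts D - j ` verts X. finite {x\<in>verts X. (j x, d) \<in> edges D \<or> (d, j x) \<in> edges D}"
    by blast
  then have "\<exists>k\<in>carrier (End D). \<forall>x\<in>verts X. k (j x) = f x" if "graph_hom f X D" for f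
    using graph_hom_extends_along_sparse_embedding[OF assms(1) _ _ that] by blast
  with j(1) show thesis using that by blast
qed

text \<open>With a finite image, \<open>f\<close> takes all its values on a finite set
  \<open>S\<close>. A vertex with arcs to all of \<open>S\<close> shares its value with some member
  of \<open>S\<close>, and \<open>f\<close> would turn that arc into a loop.\<close>

lemma infinite_image_End:
  assumes D: "universal_directed_graph D" and f: "f \<in> carrier (End D)"
  shows "infinite (f ` verts D)"
proof
  assume "finite (f ` verts D)"
  then obtain S where S: "S \<subseteq> verts D" "finite S" "f ` verts D = f ` S"
    by (metis finite_subset_image subset_refl)
  obtain v where v: "v \<in> verts D" "\<forall>a\<in>S. (v, a) \<in> edges D"
    using universal_directed_graph_extension[OF D S(2,1), of "\<lambda>_. True" "\<lambda>_. True"] by blast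
  then obtain a where a: "a \<in> S" "f v = f a" using S(3) by blast
  have "(f v, f a) \<in> edges D" using v a(1) f by (fastforce simp: carrier_End_iff graph_hom_def)
  then show False using universal_directed_graph_irrefl[OF D] a by simp
qed

section \<open>Green's relations\<close>

context monoid
begin

text \<open>A principal left ideal contains its generator and absorbs left multiplication, so each
  inclusion of ideals amounts to one factorization.\<close>

lemma green_L_iff:
  "(f, g) \<in> green_L G \<longleftrightarrow> f \<in> carrier G \<and> g \<in> carrier G \<and>
    (\<exists>p\<in>carrier G. f = p \<otimes> g) \<and> (\<exists>q\<in>carrier G. g = q \<otimes> f)"
proof -
  have "carrier G #> f \<subseteq> carrier G #> g \<longleftrightarrow> (\<exists>p\<in>carrier G. f = p \<otimes> g)"
    if fg: "f \<in> carrier G" "g \<in> carrier G" for f g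
  proof
    assume "carrier G #> f \<subseteq> carrier G #> g"
    moreover have "f \<in> carrier G #> f" using fg by (auto simp: r_coset_def intro!: bexI[of _ \<one>])
    ultimately show "\<exists>p\<in>carrier G. f = p \<otimes> g" by (auto simp: r_coset_def)
  qed (use fg in \<open>auto simp: r_coset_def m_assoc[symmetric]\<close>)
  then show ?thesis by (auto simp: green_L_def set_eq_subset)
qed

lemma green_R_iff:
  "(f, g) \<in> green_R G \<longleftrightarrow> f \<in> carrier G \<and> g \<in> carrier G \<and>
    (\<exists>p\<in>carrier G. f = g \<otimes> p) \<and> (\<exists>q\<in>carrier G. g = f \<otimes> q)"
proof -
  have "f <# carrier G \<subseteq> g <# carrier G \<longleftrightarrow> (\<exists>p\<in>carrier G. f = g \<otimes> p)"
    if fg: "f \<in> carrier G" "g \<in> carrier G" for f g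
  proof
    assume "f <# carrier G \<subseteq> g <# carrier G"
    moreover have "f \<in> f <# carrier G" using fg by (auto simp: l_coset_def intro!: bexI[of _ \<one>])
    ultimately show "\<exists>p\<in>carrier G. f = g \<otimes> p" by (auto simp: l_coset_def)
  qed (use fg in \<open>auto simp: l_coset_def m_assoc\<close>)
  then show ?thesis by (auto simp: green_R_def set_eq_subset)
qed

text \<open>Since \<open>f = k (h f)\<close>, the elements \<open>f\<close> and \<open>h f\<close>
  are L-related, and D is by definition L followed by R.\<close>

lemma green_R_class_subset_green_D:
  assumes "f \<in> carrier G" "h \<in> carrier G" "k \<in> carrier G" "k \<otimes> h = \<one>"
  shows "green_R G `` {h \<otimes> f} \<subseteq> green_D G `` {f}"
proof -
  have "f = k \<otimes> (h \<otimes> f)" using assms by (simp add: m_assoc[symmetric])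
  then have "(f, h \<otimes> f) \<in> green_L G" using assms by (auto simp: green_L_iff)
  then show ?thesis by (auto simp: green_D_def)
qed

text \<open>The path from \<open>f\<close> to \<open>g\<close> through \<open>f k\<close> uses R
  first and L second, opposite to the order in the definition of D. The element \<open>g h\<close>
  gives a path in the right order: it is L-related to \<open>f\<close>, and
  \<open>(g h) k = g\<close> makes it R-related to \<open>g\<close>.\<close>

lemma green_L_class_subset_green_D:
  assumes f: "f \<in> carrier G" and hk: "h \<in> carrier G" "k \<in> carrier G" "k \<otimes> h = \<one>"
  shows "green_L G `` {f \<otimes> k} \<subseteq> green_D G `` {f}"
proof clarify
  fix g assume "(f \<otimes> k, g) \<in> green_L G"
  then obtain p q where g: "g \<in> carrier G" and pq: "p \<in> carrier G" "q \<in> carrier G"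
    and eq: "f \<otimes> k = p \<otimes> g" "g = q \<otimes> (f \<otimes> k)"
    unfolding green_L_iff by blast
  have gh: "g \<otimes> h = q \<otimes> f" using eq(2) f hk pq by (simp add: m_assoc)
  have "p \<otimes> (g \<otimes> h) = f" using eq(1) f g hk pq by (metis m_assoc r_one)
  then have "(f, g \<otimes> h) \<in> green_L G" unfolding green_L_iff using gh f g hk pq by (metis m_closed)
  moreover have "(g \<otimes> h) \<otimes> k = g" unfolding gh using eq(2) f hk pq by (simp add: m_assoc)
  then have "(g \<otimes> h, g) \<in> green_R G" unfolding green_R_iff using g hk by (metis m_closed)
  ultimately show "(f, g) \<in> green_D G" by (auto simp: green_D_def)
qed

end

section \<open>Multiplication in the endomorphism monoid; image and kernel as invariants\<close>

lemma mult_End: "f \<otimes>\<^bsub>End G\<^esub> g = compose (verts G) f g"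
  by (simp add: End_def)

lemma one_End: "\<one>\<^bsub>End G\<^esub> = (\<lambda>x\<in>verts G. x)"
  by (simp add: End_def)

lemma End_maps_verts: "f \<in> carrier (End G) \<Longrightarrow> x \<in> verts G \<Longrightarrow> f x \<in> verts G"
  by (auto simp: carrier_End_iff graph_hom_def)

text \<open>Multiplying on the right can only shrink the image. This invariant will tell the
  elements \<open>h f\<close> apart.\<close>

lemma green_R_End_image_eq:
  assumes "directed_graph G" "(f, g) \<in> green_R (End G)"
  shows "f ` verts G = g ` verts G"
proof -
  interpret monoid "End G" using monoid_End[OF assms(1)] .
  from assms(2) obtain p q where pq: "p \<in> carrier (End G)" "q \<in> carrier (End G)"
    and eq: "f = compose (verts G) g p" "g = compose (verts G) f q"
    unfolding green_R_iff mult_End by blast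
  have "f x = g (p x)" "g x = f (q x)" if "x \<in> verts G" for x
    using that fun_cong[OF eq(1), of x] fun_cong[OF eq(2), of x] by (simp_all only: compose_eq)
  then show ?thesis using End_maps_verts[OF pq(1)] End_maps_verts[OF pq(2)] by blast
qed

text \<open>Multiplying on the left can only identify more points. This invariant will tell the
  elements \<open>f k\<close> apart.\<close>

lemma green_L_End_kernel_eq:
  assumes "directed_graph G" "(f, g) \<in> green_L (End G)" "x \<in> verts G" "y \<in> verts G"
  shows "f x = f y \<longleftrightarrow> g x = g y"
proof -
  interpret monoid "End G" using monoid_End[OF assms(1)] .
  from assms(2) obtain p q where eq: "f = compose (verts G) p g" "g = compose (verts G) q f"
    unfolding green_L_iff mult_End by blast
  have "f z = p (g z)" "g z = q (f z)" if "z \<in> verts G" for z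
    using that fun_cong[OF eq(1), of z] fun_cong[OF eq(2), of z] by (simp_all only: compose_eq)
  then show ?thesis using assms(3,4) by metis
qed

section \<open>Counting classes\<close>

lemma quotient_lepoll: "A // r \<lesssim> A"
proof -
  have "A // r = (\<lambda>x. r `` {x}) ` A" by (auto simp: quotient_def)
  then show ?thesis by (simp add: image_lepoll)
qed

text \<open>An extensional function is determined by its graph, a subset of the countable set
  \<open>A \<times> A\<close>, which \<open>c\<close> codes as a set of naturals.\<close>

lemma PiE_countable_lepoll_continuum:
  assumes "countable A"
  shows "(A \<rightarrow>\<^sub>E A) \<lesssim> (UNIV :: nat set set)"
proof -
  obtain c :: "'a \<times> 'a \<Rightarrow> nat" where c: "inj_on c (A \<times> A)"
    using assms by (metis countable_SIGMA countable_def)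
  have "inj_on (\<lambda>f. (\<lambda>x. (x, f x)) ` A) (A \<rightarrow>\<^sub>E A)"
  proof (rule inj_onI)
    fix f g assume fg: "f \<in> A \<rightarrow>\<^sub>E A" "g \<in> A \<rightarrow>\<^sub>E A" "(\<lambda>x. (x, f x)) ` A = (\<lambda>x. (x, g x)) ` A"
    have "f x = g x" if "x \<in> A" for x
    proof -
      have "(x, f x) \<in> (\<lambda>x. (x, g x)) ` A" using that fg(3) by blast
      then show ?thesis by auto
    qed
    with fg(1,2) show "f = g" by (rule PiE_ext)
  qed
  moreover have "inj_on (image c) (Pow (A \<times> A))" using c by (rule inj_on_image_Pow)
  moreover have "(\<lambda>f. (\<lambda>x. (x, f x)) ` A) ` (A \<rightarrow>\<^sub>E A) \<subseteq> Pow (A \<times> A)" by auto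
  ultimately have "inj_on (image c \<circ> (\<lambda>f. (\<lambda>x. (x, f x)) ` A)) (A \<rightarrow>\<^sub>E A)"
    by (meson comp_inj_on inj_on_subset)
  then show ?thesis by (auto simp: lepoll_def)
qed

text \<open>Classes are at most as many as endomorphisms, for any relation \<open>r\<close>; the
  bound thus serves L and R alike.\<close>

lemma quotient_End_lepoll_continuum:
  assumes "countable (verts G)"
  shows "{K \<in> carrier (End G) // r. K \<subseteq> C} \<lesssim> (UNIV :: nat set set)"
proof -
  have "{K \<in> carrier (End G) // r. K \<subseteq> C} \<lesssim> carrier (End G) // r"
    by (auto intro: subset_imp_lepoll)
  also have "carrier (End G) // r \<lesssim> carrier (End G)" by (rule quotient_lepoll)
  also have "carrier (End G) \<lesssim> (verts G \<rightarrow>\<^sub>E verts G)"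
    by (auto simp: End_def intro: subset_imp_lepoll)
  also have "(verts G \<rightarrow>\<^sub>E verts G) \<lesssim> (UNIV :: nat set set)"
    using assms by (rule PiE_countable_lepoll_continuum)
  finally show ?thesis .
qed

text \<open>By reflexivity \<open>u T\<close> lies in its own class, so equal classes make
  \<open>u S\<close> and \<open>u T\<close> related, which forces \<open>S = T\<close>.\<close>

lemma lepoll_quotient_classes:
  fixes u :: "'b \<Rightarrow> 'a"
  assumes "refl_on A r"
    and "\<And>T. u T \<in> A" "\<And>T. r `` {u T} \<subseteq> C" "\<And>S T. (u S, u T) \<in> r \<Longrightarrow> S = T"
  shows "(UNIV :: 'b set) \<lesssim> {K \<in> A // r. K \<subseteq> C}"
  unfolding lepoll_def
proof (intro exI conjI)
  show "inj (\<lambda>T :: 'b. r `` {u T})"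
  proof (rule injI)
    fix S T assume "r `` {u S} = r `` {u T}"
    moreover have "u T \<in> r `` {u T}" using assms(1,2) by (auto simp: refl_on_def)
    ultimately show "S = T" using assms(4) by blast
  qed
  show "range (\<lambda>T. r `` {u T}) \<subseteq> {K \<in> A // r. K \<subseteq> C}"
    using assms(2,3) by (auto simp: quotient_def)
qed

section \<open>Lower bounds on the numbers of classes\<close>

text \<open>The kernel of \<open>f k\<close> codes a set \<open>T\<close>: the isolated vertex
  \<open>Inr i\<close> is identified with \<open>Inl a\<close> exactly when
  \<open>i \<in> T\<close>, because \<open>f\<close> separates \<open>a\<close> from
  \<open>b\<close>.\<close>

lemma continuum_lepoll_green_L_classes:
  fixes D :: "'a graph"
  assumes D: "universal_directed_graph D" and f: "f \<in> carrier (End D)"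
  shows "(UNIV :: nat set set) \<lesssim>
    {K \<in> carrier (End D) // green_L (End D). K \<subseteq> green_D (End D) `` {f}}"
proof -
  have dg: "directed_graph D" and cnt: "countable (verts D)"
    using D by (auto simp: universal_directed_graph_def fraisse_limit_def)
  interpret monoid "End D" using monoid_End[OF dg] .
  obtain a b where ab: "a \<in> verts D" "b \<in> verts D" "f a \<noteq> f b"
  proof -
    obtain a where a: "a \<in> verts D"
      using infinite_image_End[OF D f] by fastforce
    have "\<not> f ` verts D \<subseteq> {f a}"
      using infinite_image_End[OF D f] finite_subset by blast
    then obtain b where "b \<in> verts D" "f a \<noteq> f b" by fastforce
    with a show thesis by (rule that)
  qed
  define X :: "('a + nat) graph" where
    "X = (Inl ` verts D \<union> range Inr, {(Inl x, Inl y) |x y. (x, y) \<in> edges D})"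
  have X: "directed_graph X" "countable (verts X)"
    using dg cnt by (auto simp: X_def directed_graph_def irrefl_def)
  obtain j where j: "embedding j X D"
    and ext: "\<And>g. graph_hom g X D \<Longrightarrow> \<exists>k\<in>carrier (End D). \<forall>x\<in>verts X. k (j x) = g x"
    using exists_embedding_extending_homs[OF D X] by blast
  have j_in: "j x \<in> verts D" if "x \<in> verts X" for x using j that by (auto simp: embedding_def)
  have Inl_in: "Inl x \<in> verts X" if "x \<in> verts D" for x using that by (simp add: X_def)
  have Inr_in: "Inr i \<in> verts X" for i by (simp add: X_def)
  have j_edge: "(j (Inl x), j (Inl y)) \<in> edges D" if xy: "(x, y) \<in> edges D" for x y
  proof -
    have "(Inl x, Inl y) \<in> edges X" using xy by (simp add: X_def)
    then show ?thesis
      using j Inl_in universal_directed_graph_edges[OF D xy] by (auto simp: embedding_def)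
  qed
  define h where "h = (\<lambda>x\<in>verts D. j (Inl x))"
  have h: "h \<in> carrier (End D)"
    using j_in Inl_in j_edge universal_directed_graph_edges[OF D]
    by (auto simp: h_def carrier_End_iff graph_hom_def)
  \<comment> \<open>No arc of \<open>X\<close> meets an \<open>Inr\<close> vertex, so those values
    are free; on the \<open>Inl\<close> copy the map is the inverse of \<open>Inl\<close>, which
    makes \<open>k\<close> a left inverse of \<open>h\<close>.\<close>
  have "\<exists>k\<in>carrier (End D). \<forall>x\<in>verts X.
      k (j x) = (case x of Inl y \<Rightarrow> y | Inr i \<Rightarrow> if i \<in> T then a else b)" for T
    using ab by (intro ext) (auto simp: graph_hom_def X_def)
  then obtain k where k: "\<And>T. k T \<in> carrier (End D)" and kj: "\<And>T x. x \<in> verts X \<Longrightarrow>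
      k T (j x) = (case x of Inl y \<Rightarrow> y | Inr i \<Rightarrow> if i \<in> T then a else b)"
    by metis
  have kh: "k T \<otimes>\<^bsub>End D\<^esub> h = \<one>\<^bsub>End D\<^esub>" for T
    by (auto simp: mult_End one_End compose_def h_def kj Inl_in fun_eq_iff)
  show ?thesis
  proof (rule lepoll_quotient_classes)
    show "refl_on (carrier (End D)) (green_L (End D))" by (auto simp: refl_on_def green_L_def)
    show "f \<otimes>\<^bsub>End D\<^esub> k T \<in> carrier (End D)" for T using f k by simp
    show "green_L (End D) `` {f \<otimes>\<^bsub>End D\<^esub> k T} \<subseteq> green_D (End D) `` {f}" for T
      using green_L_class_subset_green_D[OF f h k kh] .
    have fk: "i \<in> T \<longleftrightarrow> (f \<otimes>\<^bsub>End D\<^esub> k T) (j (Inr i)) = (f \<otimes>\<^bsub>End D\<^esub> k T) (j (Inl a))" for i T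
      using ab by (auto simp: mult_End compose_eq j_in Inl_in Inr_in kj)
    fix S T assume "(f \<otimes>\<^bsub>End D\<^esub> k S, f \<otimes>\<^bsub>End D\<^esub> k T) \<in> green_L (End D)"
    from green_L_End_kernel_eq[OF dg this j_in[OF Inr_in] j_in[OF Inl_in[OF ab(1)]]]
    show "S = T" using fk by blast
  qed
qed

text \<open>The image of \<open>h f\<close> codes a set \<open>T\<close> by which of the two copies
  of each \<open>c i\<close> it contains.\<close>

lemma continuum_lepoll_green_R_classes:
  fixes D :: "'a graph"
  assumes D: "universal_directed_graph D" and f: "f \<in> carrier (End D)"
  shows "(UNIV :: nat set set) \<lesssim>
    {K \<in> carrier (End D) // green_R (End D). K \<subseteq> green_D (End D) `` {f}}"
proof -
  have dg: "directed_graph D" and cnt: "countable (verts D)"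
    using D by (auto simp: universal_directed_graph_def fraisse_limit_def)
  interpret monoid "End D" using monoid_End[OF dg] .
  \<comment> \<open>The coding vertices must lie in the image of \<open>f\<close>, since
    \<open>h f\<close> shows the choices made by \<open>h\<close> only there.\<close>
  obtain c :: "nat \<Rightarrow> 'a" where c: "inj c" "range c \<subseteq> f ` verts D"
    using infinite_countable_subset[OF infinite_image_End[OF D f]] by blast
  have f_in: "f x \<in> verts D" if "x \<in> verts D" for x using f that by (rule End_maps_verts)
  \<comment> \<open>An arc of \<open>D\<close> yields arcs between all copies of its endpoints, so
    every choice of one copy per vertex is a homomorphism.\<close>
  define X :: "('a \<times> bool) graph" where
    "X = (verts D \<times> UNIV, {((x, s), (y, t)) |x y s t. (x, y) \<in> edges D})"
  have X: "directed_graph X" "countable (verts X)"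
    using dg cnt by (auto simp: X_def directed_graph_def irrefl_def)
  obtain j where j: "embedding j X D"
    and ext: "\<And>g. graph_hom g X D \<Longrightarrow> \<exists>k\<in>carrier (End D). \<forall>x\<in>verts X. k (j x) = g x"
    using exists_embedding_extending_homs[OF D X] by blast
  have j_in: "j (x, s) \<in> verts D" if "x \<in> verts D" for x s
    using j that by (auto simp: embedding_def X_def)
  have j_eq: "j (x, s) = j (y, t) \<longleftrightarrow> x = y \<and> s = t" if "x \<in> verts D" "y \<in> verts D" for x y s t
    using j that inj_onD[of j "verts X" "(x, s)" "(y, t)"] by (auto simp: embedding_def X_def)
  have "graph_hom fst X D" by (auto simp: graph_hom_def X_def)
  then obtain k where k: "k \<in> carrier (End D)" and "\<And>x. x \<in> verts X \<Longrightarrow> k (j x) = fst x"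
    using ext by blast
  then have kj: "k (j (x, s)) = x" if "x \<in> verts D" for x s
    using that by (simp add: X_def)
  define h where "h T = (\<lambda>x\<in>verts D. j (x, x \<in> c ` T))" for T
  have h: "h T \<in> carrier (End D)" for T
    using j j_in universal_directed_graph_edges[OF D]
    by (auto simp: h_def carrier_End_iff graph_hom_def embedding_def X_def)
  have kh: "k \<otimes>\<^bsub>End D\<^esub> h T = \<one>\<^bsub>End D\<^esub>" for T
    by (auto simp: mult_End one_End compose_def h_def kj fun_eq_iff)
  show ?thesis
  proof (rule lepoll_quotient_classes)
    show "refl_on (carrier (End D)) (green_R (End D))" by (auto simp: refl_on_def green_R_def)
    show "h T \<otimes>\<^bsub>End D\<^esub> f \<in> carrier (End D)" for T using f h by simp
    show "green_R (End D) `` {h T \<otimes>\<^bsub>End D\<^esub> f} \<subseteq> green_D (End D) `` {f}" for T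
      using green_R_class_subset_green_D[OF f h k kh] .
    have hf: "i \<in> T \<longleftrightarrow> j (c i, True) \<in> (h T \<otimes>\<^bsub>End D\<^esub> f) ` verts D" for i T
    proof -
      obtain x where x: "x \<in> verts D" "c i = f x" using c(2) by blast
      have "j (c i, True) \<in> (h T \<otimes>\<^bsub>End D\<^esub> f) ` verts D \<longleftrightarrow> c i \<in> c ` T"
        using x f_in by (auto simp: mult_End compose_eq h_def j_eq image_iff)
      then show ?thesis using c(1) by (simp add: inj_image_mem_iff)
    qed
    fix S T assume "(h S \<otimes>\<^bsub>End D\<^esub> f, h T \<otimes>\<^bsub>End D\<^esub> f) \<in> green_R (End D)"
    from green_R_End_image_eq[OF dg this] have "i \<in> S \<longleftrightarrow> i \<in> T" for i
      by (simp only: hf[of i S] hf[of i T])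
    then show "S = T" by blast
  qed
qed

theorem theorem4p6:
  fixes D :: "'a graph" and C :: "('a \<Rightarrow> 'a) set"
  assumes "universal_directed_graph D"
    and "regular_D_class (End D) C"
  shows "{K \<in> carrier (End D) // green_L (End D). K \<subseteq> C} \<approx> (UNIV :: nat set set) \<and>
         {K \<in> carrier (End D) // green_R (End D). K \<subseteq> C} \<approx> (UNIV :: nat set set)"
proof -
  have "countable (verts D)"
    using assms(1) by (simp add: universal_directed_graph_def fraisse_limit_def)
  note upper = quotient_End_lepoll_continuum[OF this]
  obtain f where f: "f \<in> carrier (End D)" and C: "C = green_D (End D) `` {f}"
    using assms(2) by (auto simp: regular_D_class_def elim: quotientE)
  show ?thesis
    unfolding C
    using upper continuum_lepoll_green_L_classes[OF assms(1) f]
      continuum_lepoll_green_R_classes[OF assms(1) f]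
    by (blast intro: lepoll_antisym)
qed

end
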